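(* For every integer $t\geq 2$, if $G$ is a triangle-free $K_{2,t}$-free graph with diameter $2$ and $G$ is not a star graph, then $$\Delta(G)\leq (t-1)\big( (t-1)\delta(G)-t+2\big)-t+2.$$
   Context: All graphs are finite, simple and undirected. A graph is $H$-free if it contains no (not necessarily induced) subgraph isomorphic to $H$; triangle-free means $K_3$-free. A graph has diameter $2$ if it is connected and the maximum distance between two of its vertices is exactly $2$. A star graph is a graph isomorphic to $K_{1,m}$ for some $m\geq 1$. $\delta(G)$ and $\Delta(G)$ denote the minimum and maximum degree of $G$, respectively. *)

theory Defs
  imports "Graph_Theory.Graph_Theory"
begin

text \<open>
  A finite simple undirected graph is the locale \<open>graph\<close>: a finite symmetric digraph
  without loops and parallel arcs, each undirected edge being a pair of opposite arcs. Hence the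
  degree of a vertex is its out-degree, and the length of a walk is its cost for unit weights.
\<close>

text \<open>
  The class of forbidden graphs is a predicate \<open>P\<close> on graphs, such as \<open>complete_digraph n\<close> or
  \<open>complete_bipartite_digraph m n\<close>, that already describes a graph up to isomorphism.
  As \<open>subgraph\<close> is the not necessarily induced subgraph relation, no explicit isomorphism is needed.
\<close>

definition free_of ::
  "(('a,'b) pre_digraph \<Rightarrow> bool) \<Rightarrow> ('a,'b) pre_digraph \<Rightarrow> bool" where
  "free_of P G \<longleftrightarrow> \<not> (\<exists>H. subgraph H G \<and> P H)"

definition star_graph :: "('a,'b) pre_digraph \<Rightarrow> bool" where
  "star_graph G \<longleftrightarrow> (\<exists>m\<ge>1. complete_bipartite_digraph 1 m G)"

definition graph_dist :: "('a,'b) pre_digraph \<Rightarrow> 'a \<Rightarrow> 'a \<Rightarrow> ereal" where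
  "graph_dist G u v = wf_digraph.\<mu> G (\<lambda>_. 1) u v"

text \<open>
  The library's \<open>connected\<close> requires a nonempty vertex set, so \<open>Max\<close> and \<open>Min\<close> below are
  applied to finite nonempty sets for every connected finite graph.
\<close>

definition has_diameter :: "('a,'b) pre_digraph \<Rightarrow> nat \<Rightarrow> bool" where
  "has_diameter G d \<longleftrightarrow> connected G \<and>
     Max {graph_dist G u v | u v. u \<in> verts G \<and> v \<in> verts G} = ereal (real d)"

definition min_degree :: "('a,'b) pre_digraph \<Rightarrow> nat" where
  "min_degree G = Min (out_degree G ` verts G)"

definition max_degree :: "('a,'b) pre_digraph \<Rightarrow> nat" where
  "max_degree G = Max (out_degree G ` verts G)"

end

(* For nonadjacent x and y with c common neighbours, every private neighbour of x has a common
   neighbour with y, which by triangle-freeness is a private neighbour of y. As two vertices have at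
   most t - 1 common neighbours, this gives d(x) - c <= (t - 1) * (d(y) - c), hence d(x) <= f (d(y))
   for f(d) = (t - 1) * d - t + 2. The bound of the theorem is f (f \<delta>): if x of maximum and y of
   minimum degree are adjacent, one goes through a vertex z that is adjacent to neither. Such a z
   exists unless G is a star or d(x) < t, and in the latter case \<delta> >= 2 makes the bound at least t. *)

theory Submission
  imports Defs
begin

section \<open>The counting argument, for a graph given as an edge relation\<close>

locale triangle_free_diam2 =
  fixes V :: "'a set" and E :: "('a \<times> 'a) set" and t :: nat
  assumes fin: "finite V" and E_sub: "E \<subseteq> V \<times> V" and sym: "(u, v) \<in> E \<Longrightarrow> (v, u) \<in> E"
    and triangle_free: "(u, v) \<in> E \<Longrightarrow> (v, w) \<in> E \<Longrightarrow> (u, w) \<notin> E"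
    and codegree_less: "u \<in> V \<Longrightarrow> v \<in> V \<Longrightarrow> u \<noteq> v \<Longrightarrow> card (E `` {u} \<inter> E `` {v}) < t"
    and common_neighbour:
      "u \<in> V \<Longrightarrow> v \<in> V \<Longrightarrow> u \<noteq> v \<Longrightarrow> (u, v) \<notin> E \<Longrightarrow> \<exists>w. (u, w) \<in> E \<and> (v, w) \<in> E"
    and t_ge_2: "2 \<le> t"
begin

lemma E_commute: "(u, v) \<in> E \<longleftrightarrow> (v, u) \<in> E"
  using sym by blast

lemma irrefl: "(u, u) \<notin> E"
  using triangle_free by blast

lemma finite_neighbours: "finite (E `` {u})"
  by (rule finite_subset[OF _ fin]) (use E_sub in auto)

lemma degree_le_nonadjacent:
  assumes x: "x \<in> V" and y: "y \<in> V" and "x \<noteq> y" "(x, y) \<notin> E"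
  shows "int (card (E `` {x})) \<le> (int t - 1) * int (card (E `` {y})) - int t + 2"
proof -
  define C where "C = E `` {x} \<inter> E `` {y}"
  have finC: "finite C" unfolding C_def using finite_neighbours by blast
  have "C \<noteq> {}" using common_neighbour[OF assms] unfolding C_def by auto
  then have c1: "1 \<le> card C" using finC by (simp add: Suc_le_eq card_gt_0_iff)
  have "E `` {x} - C \<subseteq> (\<Union>b\<in>E `` {y} - C. E `` {x} \<inter> E `` {b})"
  proof
    fix a assume a: "a \<in> E `` {x} - C"
    then have aE: "(x, a) \<in> E" "(a, y) \<notin> E" unfolding C_def by (auto simp: E_commute)
    have "a \<in> V" "a \<noteq> y" using aE(1) E_sub assms(4) by auto
    from common_neighbour[OF this(1) y this(2) aE(2)]
    obtain b where b: "(a, b) \<in> E" "(y, b) \<in> E" by blast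
    \<comment> \<open>If \<open>b\<close> were in \<open>C\<close>, the vertices \<open>x\<close>,
      \<open>a\<close>, \<open>b\<close> would form a triangle.\<close>
    then have "b \<notin> C" using triangle_free[OF aE(1) b(1)] unfolding C_def by auto
    then show "a \<in> (\<Union>b\<in>E `` {y} - C. E `` {x} \<inter> E `` {b})"
      using aE b by (auto simp: E_commute)
  qed
  then have "card (E `` {x} - C) \<le> card (\<Union>b\<in>E `` {y} - C. E `` {x} \<inter> E `` {b})"
    by (intro card_mono) (auto simp: finite_neighbours)
  also have "\<dots> \<le> (\<Sum>b\<in>E `` {y} - C. card (E `` {x} \<inter> E `` {b}))"
    by (intro card_UN_le) (simp add: finite_neighbours)
  also have "\<dots> \<le> of_nat (card (E `` {y} - C)) * (t - 1)"
  proof (rule sum_bounded_above)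
    fix b assume "b \<in> E `` {y} - C"
    then have "b \<in> V" "x \<noteq> b" using E_sub assms(4) by (auto simp: E_commute)
    with codegree_less[OF x] show "card (E `` {x} \<inter> E `` {b}) \<le> t - 1" by fastforce
  qed
  finally have le: "card (E `` {x} - C) \<le> card (E `` {y} - C) * (t - 1)" by simp
  have split: "int (card (E `` {z} - C)) = int (card (E `` {z})) - int (card C)"
    if "C \<subseteq> E `` {z}" for z
    using that finC card_mono[OF finite_neighbours that] by (simp add: card_Diff_subset)
  have "int (card (E `` {x} - C)) \<le> int (card (E `` {y} - C)) * (int t - 1)"
    using le[folded of_nat_le_iff[where 'a = int]] t_ge_2 by (simp add: of_nat_diff)
  moreover have "C \<subseteq> E `` {x}" "C \<subseteq> E `` {y}" unfolding C_def by auto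
  ultimately have "int (card (E `` {x})) - int (card C)
      \<le> (int (card (E `` {y})) - int (card C)) * (int t - 1)"
    by (simp add: split)
  \<comment> \<open>With c = \<open>card C\<close>, the estimate so far reads d(x) <= (t - 1) * d(y)
    - (t - 2) * c; it is weakest for c = 1.\<close>
  moreover have "int t - 2 \<le> (int t - 2) * int (card C)"
    using c1 t_ge_2 by (simp add: mult_le_cancel_left1)
  ultimately show ?thesis by (simp add: algebra_simps)
qed

text \<open>For the function f of the overview, f(d) - d = (t - 2) * (d - 1), and f has the positive
  slope t - 1. This allows one application of f to be weakened to two and two estimates to be
  chained.\<close>

lemma bound_mono:
  assumes "1 \<le> c" "(c::int) \<le> d"
  shows "d \<le> (int t - 1) * d - int t + 2"
    and "(int t - 1) * c - int t + 2 \<le> (int t - 1) * d - int t + 2"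
proof -
  have "0 \<le> (int t - 2) * (d - 1)" using assms t_ge_2 by simp
  then show "d \<le> (int t - 1) * d - int t + 2" by (simp add: algebra_simps)
  show "(int t - 1) * c - int t + 2 \<le> (int t - 1) * d - int t + 2"
    using mult_left_mono[OF assms(2), of "int t - 1"] t_ge_2 by linarith
qed

lemma degree_pos:
  assumes "x \<in> V" "y \<in> V" "x \<noteq> y"
  shows "1 \<le> card (E `` {x})"
proof -
  \<comment> \<open>Either \<open>y\<close> itself is a neighbour of \<open>x\<close>, or a common
    neighbour exists.\<close>
  have "E `` {x} \<noteq> {}" using common_neighbour[OF assms] by auto
  then show ?thesis using finite_neighbours[of x] by (simp add: Suc_le_eq card_gt_0_iff)
qed

text \<open>The leaf \<open>y\<close> reaches other vertices only through \<open>x\<close>, so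
  distance at most 2 makes every other vertex a neighbour of \<open>x\<close>. An edge avoiding
  \<open>x\<close> would then close a triangle.\<close>

lemma star_of_leaf:
  assumes y: "y \<in> V" and E: "E `` {y} = {x}"
  shows "V = insert x (E `` {x})" and "E = {x} \<times> E `` {x} \<union> E `` {x} \<times> {x}"
proof -
  have yx: "(y, x) \<in> E" using E by auto
  show V: "V = insert x (E `` {x})"
  proof (intro equalityI subsetI)
    fix v assume v: "v \<in> V"
    show "v \<in> insert x (E `` {x})"
    proof (cases "v = y \<or> v = x")
      case True
      then show ?thesis using sym[OF yx] by blast
    next
      case False
      then have "(v, y) \<notin> E" using E sym by blast
      with False common_neighbour[OF v y] obtain w where "(v, w) \<in> E" "(y, w) \<in> E" by blast
      moreover from this(2) have "w = x" using E by auto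
      ultimately show ?thesis using sym by blast
    qed
  qed (use yx E_sub in auto)
  show "E = {x} \<times> E `` {x} \<union> E `` {x} \<times> {x}"
  proof (intro equalityI subsetI)
    fix e assume e: "e \<in> E"
    obtain u v where uv: "e = (u, v)" by force
    have "u \<in> insert x (E `` {x})" "v \<in> insert x (E `` {x})"
      using e uv E_sub V by auto
    moreover have "\<not> ((x, u) \<in> E \<and> (x, v) \<in> E)" using triangle_free[of x u v] e uv by blast
    ultimately show "e \<in> {x} \<times> E `` {x} \<union> E `` {x} \<times> {x}"
      using e uv irrefl by (auto simp: E_commute)
  qed (auto simp: E_commute)
qed

text \<open>The locale encodes only distances of at most 2. Of the triangle-free graphs of smaller
  diameter, the single vertex is excluded by \<open>V \<noteq> {y}\<close> and the single edge, a
  star, by \<open>not_star\<close>.\<close>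

lemma degree_le:
  assumes x: "x \<in> V" and y: "y \<in> V" and "V \<noteq> {y}"
    and min: "\<And>v. v \<in> V \<Longrightarrow> card (E `` {y}) \<le> card (E `` {v})"
    and not_star: "\<And>c. V = insert c (E `` {c}) \<Longrightarrow> E \<noteq> {c} \<times> E `` {c} \<union> E `` {c} \<times> {c}"
  shows "int (card (E `` {x}))
    \<le> (int t - 1) * ((int t - 1) * int (card (E `` {y})) - int t + 2) - int t + 2"
proof -
  define f where "f d = (int t - 1) * d - int t + 2" for d
  define d where "d v = int (card (E `` {v}))" for v
  note f_ge = bound_mono(1)[OF _ order_refl, folded f_def]
  note f_mono = bound_mono(2)[folded f_def]
  note f_nonadj = degree_le_nonadjacent[folded f_def d_def]
  obtain v where "v \<in> V" "v \<noteq> y" using assms(3) y by blast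
  then have d1: "1 \<le> d y" using degree_pos[OF y] unfolding d_def by fastforce
  then have f1: "1 \<le> f (d y)" using f_ge by force
  have "d x \<le> f (f (d y))"
  proof (cases "(x, y) \<in> E")
    case False
    \<comment> \<open>The case \<open>x = y\<close> is included, where \<open>f_ge\<close> replaces
      the estimate for nonadjacent vertices.\<close>
    have "d x \<le> f (d y)"
      using f_nonadj[OF x y _ False] f_ge[OF d1] by (cases "x = y") auto
    then show ?thesis using f_ge[OF f1] by linarith
  next
    case xy: True
    have d2: "2 \<le> d y"
    proof (rule ccontr)
      assume "\<not> 2 \<le> d y"
      then have "card (E `` {y}) = 1" using d1 unfolding d_def by linarith
      then obtain c where "E `` {y} = {c}" by (auto simp: card_1_singleton_iff)
      from star_of_leaf[OF y this] not_star show False by blast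
    qed
    have "\<exists>x'. (y, x') \<in> E \<and> x' \<noteq> x"
    proof (rule ccontr)
      assume "\<nexists>x'. (y, x') \<in> E \<and> x' \<noteq> x"
      then have "E `` {y} \<subseteq> {x}" by auto
      from card_mono[OF _ this] d2 show False unfolding d_def by simp
    qed
    then obtain x' where x': "(y, x') \<in> E" "x' \<noteq> x" by blast
    have x'V: "x' \<in> V" using x' E_sub by auto
    have xx': "(x, x') \<notin> E" by (rule triangle_free[OF xy x'(1)])
    show ?thesis
    proof (cases "E `` {x} \<subseteq> E `` {x'}")
      case True
      \<comment> \<open>By the inclusion, all neighbours of \<open>x\<close> are common neighbours
        of \<open>x\<close> and \<open>x'\<close>.\<close>
      then have "card (E `` {x}) < t"
        using codegree_less[OF x x'V] x'(2) by (auto simp: Int_absorb2)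
      moreover have "f 2 = int t" unfolding f_def by simp
      moreover have "f 2 \<le> f (d y)" by (rule f_mono) (use d2 in auto)
      ultimately show ?thesis using f_ge[OF f1] unfolding d_def by linarith
    next
      case False
      then obtain a where a: "(x, a) \<in> E" "(x', a) \<notin> E" by blast
      have aV: "a \<in> V" using a E_sub by auto
      have "a \<noteq> x'" using a xx' by auto
      \<comment> \<open>This closes a 5-cycle \<open>x\<close>, \<open>a\<close>, \<open>z\<close>,
        \<open>x'\<close>, \<open>y\<close>, in which \<open>z\<close> lies opposite to the edge
        between \<open>x\<close> and \<open>y\<close>.\<close>
      with common_neighbour[OF x'V aV] a obtain z where z: "(x', z) \<in> E" "(a, z) \<in> E" by blast
      have zV: "z \<in> V" using z E_sub by auto
      have "(x, z) \<notin> E" using triangle_free a z by blast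
      moreover have "x \<noteq> z" using z xx' sym by blast
      ultimately have "d x \<le> f (d z)" using f_nonadj x zV by blast
      moreover have "(z, y) \<notin> E" using triangle_free[OF x'(1) z(1)] sym by blast
      moreover have "z \<noteq> y" using z(2) triangle_free[OF a(1)] xy by blast
      ultimately have "d z \<le> f (d y)" "d x \<le> f (d z)" using f_nonadj[OF zV y] by auto
      \<comment> \<open>Minimality of the degree of \<open>y\<close> supplies the lower bound that
        \<open>f_mono\<close> requires.\<close>
      moreover have "1 \<le> d z" using min[OF zV] d1 unfolding d_def by linarith
      ultimately show ?thesis using f_mono by (meson order_trans)
    qed
  qed
  then show ?thesis unfolding d_def f_def .
qed

end

section \<open>From forbidden subgraphs of a digraph to its edge relation\<close>

context graph
begin

lemma arcs_ends_commute: "(u, v) \<in> arcs_ends G \<longleftrightarrow> (v, u) \<in> arcs_ends G"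
  using arcs_ends_symmetric[OF sym_arcs] by blast

text \<open>Without parallel arcs, an arc leaving \<open>u\<close> is determined by its
  head.\<close>

lemma out_degree_eq_card_neighbours: "out_degree G u = card (arcs_ends G `` {u})"
proof -
  have "arcs_ends G `` {u} = head G ` out_arcs G u"
    by (auto simp: arcs_ends_conv out_arcs_def)
  moreover have "inj_on (head G) (out_arcs G u)"
    by (rule inj_onI) (auto intro!: no_multi_arcs simp: arc_to_ends_def)
  ultimately show ?thesis by (simp add: out_degree_def card_image)
qed

text \<open>Refuting \<open>free_of\<close> takes a subgraph with exactly the prescribed edges. It
  is cut out of \<open>G\<close> by keeping the arcs with ends in \<open>A\<close>; symmetry of
  \<open>A\<close> makes it undirected.\<close>

lemma subgraph_of_ends:
  assumes S: "S \<subseteq> verts G" and A: "A \<subseteq> arcs_ends G" "A \<subseteq> S \<times> S" "sym A"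
  obtains H where "subgraph H G" "graph H" "verts H = S" "arcs_ends H = A"
proof -
  define H where "H = G\<lparr>verts := S, arcs := {e \<in> arcs G. arc_to_ends G e \<in> A}\<rparr>"
  have ends: "arc_to_ends H = arc_to_ends G" by (auto simp: H_def arc_to_ends_def)
  have AH: "arcs_ends H = A"
    using A(1) unfolding arcs_ends_def ends by (auto simp: H_def)
  interpret H: wf_digraph H
    by unfold_locales (use A(2) in \<open>auto simp: H_def arc_to_ends_def\<close>)
  have sub: "subgraph H G"
    using S by (auto simp: subgraph_def compatible_def H_def[symmetric] wf_digraph H.wf_digraph)
      (auto simp: H_def)
  interpret H: digraph H by (rule digraph_subgraph[OF sub])
  have "graph H" by (rule H.graphI) (simp add: symmetric_def AH A(3))
  with sub AH that show ?thesis by (simp add: H_def)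
qed

lemma no_triangle:
  assumes "free_of (complete_digraph 3) G" "u \<rightarrow>\<^bsub>G\<^esub> v" "v \<rightarrow>\<^bsub>G\<^esub> w"
  shows "\<not> u \<rightarrow>\<^bsub>G\<^esub> w"
proof
  assume uw: "u \<rightarrow>\<^bsub>G\<^esub> w"
  \<comment> \<open>\<open>?A\<close> has the literal shape of the arc set in
    \<open>complete_digraph_def\<close>, so that plain rewriting identifies the two.\<close>
  let ?S = "{u, v, w}" and ?A = "{(a, b). (a, b) \<in> {u, v, w} \<times> {u, v, w} \<and> a \<noteq> b}"
  have ne: "u \<noteq> v" "v \<noteq> w" "u \<noteq> w" using assms uw adj_not_same by auto
  obtain H where sub: "subgraph H G" and H: "graph H" "verts H = ?S" "arcs_ends H = ?A"
  proof (rule subgraph_of_ends)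
    show "?S \<subseteq> verts G" using assms adj_in_verts by auto
    show "?A \<subseteq> arcs_ends G"
      using assms uw by (auto simp: arcs_ends_commute)
    show "?A \<subseteq> ?S \<times> ?S" "sym ?A" by (auto intro: symI)
  qed
  have "card ?S = 3" using ne by simp
  then have "complete_digraph 3 H" by (simp only: complete_digraph_def H simp_thms)
  with assms(1) sub show False unfolding free_of_def by blast
qed

lemma card_common_neighbours_less:
  assumes "free_of (complete_bipartite_digraph 2 t) G" "u \<in> verts G" "v \<in> verts G" "u \<noteq> v"
  shows "card (arcs_ends G `` {u} \<inter> arcs_ends G `` {v}) < t"
proof (rule ccontr)
  assume "\<not> ?thesis"
  \<comment> \<open>Exactly \<open>t\<close> common neighbours are selected; they form the second
    side of a K_{2,t}.\<close>
  then obtain W where W: "W \<subseteq> arcs_ends G `` {u} \<inter> arcs_ends G `` {v}" "card W = t"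
    using obtain_subset_with_card_n by (metis not_less)
  let ?U = "{u, v}"
  have disj: "?U \<inter> W = {}" using W(1) adj_not_same by auto
  obtain H where sub: "subgraph H G"
    and H: "graph H" "verts H = ?U \<union> W" "arcs_ends H = ?U \<times> W \<union> W \<times> ?U"
  proof (rule subgraph_of_ends)
    show "?U \<union> W \<subseteq> verts G" using assms W(1) adj_in_verts by auto
    show "?U \<times> W \<union> W \<times> ?U \<subseteq> arcs_ends G"
      using W(1) by (auto simp: arcs_ends_commute)
    show "?U \<times> W \<union> W \<times> ?U \<subseteq> (?U \<union> W) \<times> (?U \<union> W)" "sym (?U \<times> W \<union> W \<times> ?U)"
      by (auto intro: symI)
  qed
  have "card ?U = 2" using assms(4) by simp
  then have "complete_bipartite_digraph 2 t H"
    unfolding complete_bipartite_digraph_def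
    by (intro conjI exI[of _ ?U] exI[of _ W] H disj W(2))
  with assms(1) sub show False unfolding free_of_def by blast
qed

text \<open>\<open>verts G \<noteq> {c}\<close> ensures at least one leaf, as
  \<open>star_graph\<close> demands.\<close>

lemma star_graphI:
  assumes "verts G = insert c N" "c \<notin> N" "arcs_ends G = {c} \<times> N \<union> N \<times> {c}" "verts G \<noteq> {c}"
  shows "star_graph G"
proof -
  have "finite N" using assms(1) finite_verts by (metis finite_insert)
  moreover have "N \<noteq> {}" using assms by auto
  ultimately have "1 \<le> card N" by (simp add: Suc_le_eq card_gt_0_iff)
  moreover have "complete_bipartite_digraph 1 (card N) G"
    unfolding complete_bipartite_digraph_def
    using assms graph_axioms by (intro conjI exI[of _ "{c}"] exI[of _ N]) auto
  ultimately show ?thesis by (auto simp: star_graph_def)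
qed

section \<open>Distances, walks and diameter 2\<close>

lemma awalk_cost_1: "awalk_cost (\<lambda>_. 1) p = real (length p)"
  by (induction p) auto

text \<open>The distance is an infimum over walks; a strict upper bound on an infimum yields a
  witness.\<close>

lemma graph_dist_less_awalk:
  assumes "graph_dist G u v < ereal (real n)"
  obtains p where "awalk u p v" "length p < n"
  using assms unfolding graph_dist_def \<mu>_def INF_less_iff awalk_cost_1 by auto

lemma diameter_le:
  assumes "has_diameter G d" "u \<in> verts G" "v \<in> verts G"
  shows "graph_dist G u v \<le> ereal (real d)"
proof -
  \<comment> \<open>As an image of a finite product the set is finite, which \<open>Max_ge\<close>
    requires.\<close>
  have "{graph_dist G u v | u v. u \<in> verts G \<and> v \<in> verts G}
      = (\<lambda>(u, v). graph_dist G u v) ` (verts G \<times> verts G)" by auto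
  then have "finite {graph_dist G u v | u v. u \<in> verts G \<and> v \<in> verts G}" by simp
  from Max_ge[OF this, of "graph_dist G u v"] assms show ?thesis
    unfolding has_diameter_def by auto
qed

lemma diameter_2_common_neighbour:
  assumes "has_diameter G 2" "u \<in> verts G" "v \<in> verts G" "u \<noteq> v" "\<not> u \<rightarrow>\<^bsub>G\<^esub> v"
  shows "\<exists>w. u \<rightarrow>\<^bsub>G\<^esub> w \<and> v \<rightarrow>\<^bsub>G\<^esub> w"
proof -
  \<comment> \<open>Raising 2 to 3 makes the bound strict; lengths are natural numbers, so the walk
    still has at most two arcs.\<close>
  have "graph_dist G u v < ereal (real 3)"
    using diameter_le[OF assms(1-3)] by (rule le_less_trans) simp
  then obtain p where p: "awalk u p v" "length p < 3" by (rule graph_dist_less_awalk)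
  have arc: "tail G e \<rightarrow>\<^bsub>G\<^esub> head G e" if "e \<in> arcs G" for e
    using that by (auto simp: arcs_ends_conv)
  consider "p = []" | e where "p = [e]" | e e' where "p = [e, e']"
    using p(2) by (cases p; cases "tl p"; cases "tl (tl p)") auto
  then show ?thesis
  proof cases
    case 1
    then show ?thesis using p(1) assms(4) by (simp add: awalk_Nil_iff)
  next
    case (2 e)
    then have "u \<rightarrow>\<^bsub>G\<^esub> v" using p(1) arc[of e] by (auto simp: awalk_Cons_iff awalk_Nil_iff)
    then show ?thesis using assms(5) by blast
  next
    case (3 e e')
    then have "u \<rightarrow>\<^bsub>G\<^esub> head G e" "head G e \<rightarrow>\<^bsub>G\<^esub> v"
      using p(1) arc[of e] arc[of e'] by (auto simp: awalk_Cons_iff awalk_Nil_iff)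
    then show ?thesis using arcs_ends_commute by blast
  qed
qed

text \<open>On a single vertex the empty walk bounds the only distance by 0.\<close>

lemma diameter_2_not_singleton:
  assumes "has_diameter G 2"
  shows "verts G \<noteq> {y}"
proof
  assume V: "verts G = {y}"
  then have "graph_dist G y y \<le> 0"
    using min_cost_le_walk_cost[of y "[]" y "\<lambda>_. 1"]
    by (simp add: graph_dist_def awalk_Nil_iff zero_ereal_def)
  moreover have "{graph_dist G u v | u v. u \<in> verts G \<and> v \<in> verts G} = {graph_dist G y y}"
    using V by auto
  ultimately show False using assms by (simp add: has_diameter_def)
qed

end

theorem theorem2:
  fixes G :: "('a,'b) pre_digraph" and t :: nat
  assumes "t \<ge> 2"
    and "graph G"
    and "free_of (complete_digraph 3) G"
    and "free_of (complete_bipartite_digraph 2 t) G"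
    and "has_diameter G 2"
    and "\<not> star_graph G"
  shows "int (max_degree G) \<le>
    (int t - 1) * ((int t - 1) * int (min_degree G) - int t + 2) - int t + 2"
proof -
  interpret graph G by fact
  interpret D: triangle_free_diam2 "verts G" "arcs_ends G" t
  proof
    show "arcs_ends G \<subseteq> verts G \<times> verts G" using adj_in_verts by auto
    show "(v, u) \<in> arcs_ends G" if "(u, v) \<in> arcs_ends G" for u v
      using that by (rule arcs_ends_symmetric[OF sym_arcs])
    show "(u, w) \<notin> arcs_ends G" if "(u, v) \<in> arcs_ends G" "(v, w) \<in> arcs_ends G" for u v w
      using no_triangle[OF assms(3) that] .
    show "card (arcs_ends G `` {u} \<inter> arcs_ends G `` {v}) < t"
      if "u \<in> verts G" "v \<in> verts G" "u \<noteq> v" for u v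
      using card_common_neighbours_less[OF assms(4) that] .
    show "\<exists>w. (u, w) \<in> arcs_ends G \<and> (v, w) \<in> arcs_ends G"
      if "u \<in> verts G" "v \<in> verts G" "u \<noteq> v" "(u, v) \<notin> arcs_ends G" for u v
      using diameter_2_common_neighbour[OF assms(5) that] .
  qed (use assms(1) in simp_all)
  have ne: "verts G \<noteq> {}"
    using assms(5) by (auto simp: has_diameter_def connected_def strongly_connected_def)
  \<comment> \<open>Both extremal degrees are attained, since the vertex set is finite and
    nonempty.\<close>
  have "max_degree G \<in> out_degree G ` verts G" "min_degree G \<in> out_degree G ` verts G"
    unfolding max_degree_def min_degree_def using ne by (auto intro!: Max_in Min_in)
  then obtain x y where x: "x \<in> verts G" "max_degree G = out_degree G x"
    and y: "y \<in> verts G" "min_degree G = out_degree G y" by blast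
  have min: "card (arcs_ends G `` {y}) \<le> card (arcs_ends G `` {v})" if "v \<in> verts G" for v
    using that y(2) unfolding min_degree_def out_degree_eq_card_neighbours[symmetric]
    by (metis Min_le finite_imageI finite_verts imageI)
  have "arcs_ends G \<noteq> {c} \<times> arcs_ends G `` {c} \<union> arcs_ends G `` {c} \<times> {c}"
    if "verts G = insert c (arcs_ends G `` {c})" for c
    \<comment> \<open>\<open>D.irrefl\<close> keeps the centre \<open>c\<close> out of its own
      neighbourhood.\<close>
    using star_graphI[OF that] D.irrefl diameter_2_not_singleton[OF assms(5)] assms(6) by auto
  from D.degree_le[OF x(1) y(1) diameter_2_not_singleton[OF assms(5)] min this]
  show ?thesis unfolding x(2) y(2) out_degree_eq_card_neighbours .
qed

end
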